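(* In the curved $4$-body problem in $\mathbb H^3$ with equal masses $m_1=m_2=m_3=m_4=:m>0$, there are no negative hyperbolic rectangular rotopulsators.
   Context: $\mathbb H^3=\{(w,x,y,z): w^2+x^2+y^2-z^2=-1,\ z>0\}$ in the Minkowski space $\mathbb R^{3,1}$, and $\cdot$ is the Lorentz inner product of signature $(+,+,+,-)$. The curved $4$-body problem in $\mathbb H^3$ describes the motion of bodies of masses $m_1,\dots,m_4>0$ with position vectors ${\bf q}_i=(w_i,x_i,y_i,z_i)$ through the equations $$\ddot{\bf q}_i=\sum_{j=1,\,j\ne i}^4\frac{m_j[{\bf q}_j+({\bf q}_i\cdot{\bf q}_j){\bf q}_i]}{[({\bf q}_i\cdot{\bf q}_j)^2-1]^{3/2}}+(\dot{\bf q}_i\cdot\dot{\bf q}_i){\bf q}_i,\qquad i=1,2,3,4,$$ with initial constraints $({\bf q}_i\cdot{\bf q}_i)(0)=-1$, $({\bf q}_i\cdot\dot{\bf q}_i)(0)=0$. Configurations with coinciding bodies are singular and excluded. Rotopulsators are orbits that rotate and may change size while maintaining their (equiangular) shape. Negative hyperbolic rotopulsators have one hyperbolic rotation, through $\beta$ in the $yz$-plane. A negative hyperbolic rectangular rotopulsator is a solution of the form $$w_1=w,\ x_1=x,\ y_1=\eta\sinh\beta,\ z_1=\eta\cosh\beta,$$ $$w_2=-w,\ x_2=-x,\ y_2=\eta\sinh\beta,\ z_2=\eta\cosh\beta,$$ $$w_3=w,\ x_3=x,\ y_3=\eta\sinh(\beta+\phi),\ z_3=\eta\cosh(\beta+\phi),$$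 $$w_4=-w,\ x_4=-x,\ y_4=\eta\sinh(\beta+\phi),\ z_4=\eta\cosh(\beta+\phi),$$ where $w,x,\eta,\beta$ are functions of $t$ with $w^2+x^2-\eta^2=-1$, $\beta$ is nonconstant, and $\phi\ne0$ is a constant. *)

theory Defs
  imports "HOL-Analysis.Analysis"
begin

text \<open>Points \<open>(w, x, y, z)\<close> of Minkowski space have components \<open>$ 1, $ 2, $ 3, $ 4\<close>.\<close>

definition lorentz :: "real ^ 4 \<Rightarrow> real ^ 4 \<Rightarrow> real"  (infixl "\<odot>" 70)
  where "a \<odot> b = a $ 1 * b $ 1 + a $ 2 * b $ 2 + a $ 3 * b $ 3 - a $ 4 * b $ 4"

definition hyperbolic_space :: "(real ^ 4) set"
  where "hyperbolic_space = {a. a \<odot> a = -1 \<and> a $ 4 > 0}"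

definition curved_acceleration ::
    "('n::finite \<Rightarrow> real) \<Rightarrow> ('n \<Rightarrow> real ^ 4) \<Rightarrow> ('n \<Rightarrow> real ^ 4) \<Rightarrow> 'n \<Rightarrow> real ^ 4"
  where "curved_acceleration m q v i =
    (\<Sum>j \<in> UNIV - {i}.
       (m j / (((q i \<odot> q j)\<^sup>2 - 1) powr (3/2))) *\<^sub>R (q j + (q i \<odot> q j) *\<^sub>R q i))
    + (v i \<odot> v i) *\<^sub>R q i"

text \<open>
  A solution on a time interval \<open>I\<close> containing the initial time \<open>0\<close>, with \<open>v\<close> the velocities.
  \<open>I\<close> is any nondegenerate interval, open or not; at an endpoint belonging to \<open>I\<close> the derivatives
  are one-sided.  Collisions are excluded throughout.
\<close>

definition curved_nbody_solution ::
    "('n::finite \<Rightarrow> real) \<Rightarrow> real set \<Rightarrow> ('n \<Rightarrow> real \<Rightarrow> real ^ 4) \<Rightarrow> bool"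
  where "curved_nbody_solution m I q \<longleftrightarrow>
    is_interval I \<and> interior I \<noteq> {} \<and> 0 \<in> I \<and>
    (\<forall>t\<in>I. \<forall>i. q i t \<in> hyperbolic_space) \<and>
    (\<forall>t\<in>I. \<forall>i j. i \<noteq> j \<longrightarrow> q i t \<noteq> q j t) \<and>
    (\<exists>v. (\<forall>t\<in>I. \<forall>i.
            (q i has_vector_derivative v i t) (at t within I) \<and>
            (v i has_vector_derivative curved_acceleration m (\<lambda>j. q j t) (\<lambda>j. v j t) i)
              (at t within I)) \<and>
         (\<forall>i. q i 0 \<odot> q i 0 = -1 \<and> q i 0 \<odot> v i 0 = 0))"

text \<open>The fourth body has index \<open>4 = 0\<close> in the four-element type \<^typ>\<open>4\<close>.\<close>

definition negative_hyperbolic_rectangular_rotopulsator ::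
    "(4 \<Rightarrow> real) \<Rightarrow> real set \<Rightarrow> (4 \<Rightarrow> real \<Rightarrow> real ^ 4) \<Rightarrow> bool"
  where "negative_hyperbolic_rectangular_rotopulsator m I q \<longleftrightarrow>
    curved_nbody_solution m I q \<and>
    (\<exists>(w :: real \<Rightarrow> real) (x :: real \<Rightarrow> real) (\<eta> :: real \<Rightarrow> real) (\<beta> :: real \<Rightarrow> real) (\<phi> :: real).
       (\<forall>t\<in>I. (w t)\<^sup>2 + (x t)\<^sup>2 - (\<eta> t)\<^sup>2 = -1) \<and>
       \<not> \<beta> constant_on I \<and>
       \<phi> \<noteq> 0 \<and>
       (\<forall>t\<in>I.
          q 1 t = vector [w t, x t, \<eta> t * sinh (\<beta> t), \<eta> t * cosh (\<beta> t)] \<and>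
          q 2 t = vector [- w t, - x t, \<eta> t * sinh (\<beta> t), \<eta> t * cosh (\<beta> t)] \<and>
          q 3 t = vector [w t, x t, \<eta> t * sinh (\<beta> t + \<phi>), \<eta> t * cosh (\<beta> t + \<phi>)] \<and>
          q 4 t = vector [- w t, - x t, \<eta> t * sinh (\<beta> t + \<phi>), \<eta> t * cosh (\<beta> t + \<phi>)]))"

end

theory Submission
  imports Defs
begin

text \<open>
  The pair of bodies 3, 4 is the image of the pair 1, 2 under the hyperbolic rotation \<open>R\<close> by the
  constant \<open>\<phi>\<close>.  Since \<open>R\<close> is a constant linear Lorentz isometry, the accelerations are related
  by \<open>R\<close> too.  But bodies 3 and 4 pull body 1 in the direction of \<open>\<phi>\<close>, while bodies 1 and 2 pull
  body 3 against it; the difference of the two pulls is a positive multiple of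
  \<open>sinh (\<beta> + 2 * \<phi>) - sinh \<beta>\<close>, which forces \<open>\<phi> = 0\<close>.
\<close>

definition hyp_rotation :: "real \<Rightarrow> real ^ 4 \<Rightarrow> real ^ 4"
  where "hyp_rotation \<phi> a =
    vector [a $ 1, a $ 2, a $ 3 * cosh \<phi> + a $ 4 * sinh \<phi>, a $ 3 * sinh \<phi> + a $ 4 * cosh \<phi>]"

lemma vector_4_nth [simp]:
  fixes a b c d :: "'a::zero"
  shows "(vector [a, b, c, d] :: 'a ^ 4) $ 1 = a"
    and "(vector [a, b, c, d] :: 'a ^ 4) $ 2 = b"
    and "(vector [a, b, c, d] :: 'a ^ 4) $ 3 = c"
    and "(vector [a, b, c, d] :: 'a ^ 4) $ 4 = d"
  by (simp_all add: vector_def)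

lemma hyp_rotation_nth [simp]:
  "hyp_rotation \<phi> a $ 1 = a $ 1"
  "hyp_rotation \<phi> a $ 2 = a $ 2"
  "hyp_rotation \<phi> a $ 3 = a $ 3 * cosh \<phi> + a $ 4 * sinh \<phi>"
  "hyp_rotation \<phi> a $ 4 = a $ 3 * sinh \<phi> + a $ 4 * cosh \<phi>"
  unfolding hyp_rotation_def by simp_all

lemma bounded_linear_hyp_rotation: "bounded_linear (hyp_rotation \<phi>)"
proof -
  have "linear (hyp_rotation \<phi>)"
    by (rule linearI) (simp_all add: vec_eq_iff forall_4 algebra_simps)
  then show ?thesis
    by (simp add: linear_conv_bounded_linear)
qed

lemma lorentz_hyp_rotation: "hyp_rotation \<phi> a \<odot> hyp_rotation \<phi> b = a \<odot> b"
proof -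
  have "(cosh \<phi>)\<^sup>2 = (sinh \<phi>)\<^sup>2 + 1"
    by (simp add: cosh_square_eq)
  then show ?thesis
    unfolding lorentz_def hyp_rotation_nth by algebra
qed

text \<open>Both \<open>g'\<close> and \<open>R f'\<close> are derivatives of \<open>g\<close> at
  \<open>t\<close> within \<open>I\<close>. They agree because a nondegenerate interval has no
  isolated points, so one-sided derivatives at its endpoints are unique too.\<close>

lemma has_vector_derivative_linear_image_unique:
  fixes f g :: "real \<Rightarrow> 'a::euclidean_space"
  assumes "bounded_linear R" and "is_interval I" and "interior I \<noteq> {}" and "t \<in> I"
    and "\<And>s. s \<in> I \<Longrightarrow> g s = R (f s)"
    and "(f has_vector_derivative f') (at t within I)"
    and "(g has_vector_derivative g') (at t within I)"
  shows "g' = R f'"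
proof -
  have "I \<noteq> {t}"
    using assms(3) by auto
  then have "t islimpt I"
    using connected_imp_perfect is_interval_connected assms(2,4) by blast
  then have "at t within I \<noteq> bot"
    by (simp add: trivial_limit_within)
  moreover have "((\<lambda>s. R (f s)) has_vector_derivative R f') (at t within I)"
    by (rule bounded_linear.has_vector_derivative[OF assms(1,6)])
  then have "(g has_vector_derivative R f') (at t within I)"
    by (rule has_vector_derivative_transform[rotated 2]) (use assms(4,5) in auto)
  ultimately show ?thesis
    using assms(7) vector_derivative_unique_within by blast
qed

lemma UNIV_4_diff:
  "(UNIV :: 4 set) - {1} = {2, 3, 4}" "(UNIV :: 4 set) - {3} = {1, 2, 4}"
  using exhaust_4 by force+

text \<open>The algebraic core, at a single instant: the motion enters only through the two rotation
  relations \<open>v\<close> and \<open>acc\<close>.\<close>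

lemma rectangle_rotation_angle_zero:
  fixes q :: "4 \<Rightarrow> real ^ 4"
  assumes \<mu>: "\<mu> > 0" and m: "m 1 = \<mu>" "m 2 = \<mu>" "m 3 = \<mu>" "m 4 = \<mu>"
    and h: "w\<^sup>2 + x\<^sup>2 - \<eta>\<^sup>2 = -1" and \<eta>: "\<eta> > 0"
    and q1: "q 1 = vector [w, x, \<eta> * sinh \<beta>, \<eta> * cosh \<beta>]"
    and q2: "q 2 = vector [- w, - x, \<eta> * sinh \<beta>, \<eta> * cosh \<beta>]"
    and q3: "q 3 = vector [w, x, \<eta> * sinh (\<beta> + \<phi>), \<eta> * cosh (\<beta> + \<phi>)]"
    and q4: "q 4 = vector [- w, - x, \<eta> * sinh (\<beta> + \<phi>), \<eta> * cosh (\<beta> + \<phi>)]"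
    and v: "v 3 = hyp_rotation \<phi> (v 1)"
    and acc: "curved_acceleration m q v 3 = hyp_rotation \<phi> (curved_acceleration m q v 1)"
  shows "\<phi> = 0"
proof (rule ccontr)
  assume \<phi>: "\<phi> \<noteq> 0"
  interpret R: bounded_linear "hyp_rotation \<phi>"
    by (rule bounded_linear_hyp_rotation)
  define F where "F i j = \<mu> / (((q i \<odot> q j)\<^sup>2 - 1) powr (3/2))" for i j
  have R1: "hyp_rotation \<phi> (q 1) = q 3" and R2: "hyp_rotation \<phi> (q 2) = q 4"
    by (simp_all add: vec_eq_iff forall_4 q1 q2 q3 q4 sinh_add cosh_add algebra_simps)
  \<comment> \<open>Opposite sides of the rectangle have equal Lorentz products, and so do its
    diagonals. Hence \<open>F 1 2\<close>, \<open>F 1 3\<close> and \<open>F 1 4\<close> are the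
    only coefficients for body 1 and body 3 alike.\<close>
  have c34: "q 3 \<odot> q 4 = q 1 \<odot> q 2"
    using lorentz_hyp_rotation[of \<phi> "q 1" "q 2"] by (simp add: R1 R2)
  have c31: "q 3 \<odot> q 1 = q 1 \<odot> q 3" and c32: "q 3 \<odot> q 2 = q 1 \<odot> q 4"
    by (simp_all add: lorentz_def q1 q2 q3 q4 algebra_simps)
  have vv: "v 3 \<odot> v 3 = v 1 \<odot> v 1"
    by (simp add: v lorentz_hyp_rotation)
  have a1: "curved_acceleration m q v 1 =
      F 1 2 *\<^sub>R (q 2 + (q 1 \<odot> q 2) *\<^sub>R q 1) + F 1 3 *\<^sub>R (q 3 + (q 1 \<odot> q 3) *\<^sub>R q 1)
      + F 1 4 *\<^sub>R (q 4 + (q 1 \<odot> q 4) *\<^sub>R q 1) + (v 1 \<odot> v 1) *\<^sub>R q 1"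
    by (simp add: curved_acceleration_def UNIV_4_diff F_def m)
  have a3: "curved_acceleration m q v 3 =
      F 1 3 *\<^sub>R (q 1 + (q 1 \<odot> q 3) *\<^sub>R q 3) + F 1 4 *\<^sub>R (q 2 + (q 1 \<odot> q 4) *\<^sub>R q 3)
      + F 1 2 *\<^sub>R (q 4 + (q 1 \<odot> q 2) *\<^sub>R q 3) + (v 1 \<odot> v 1) *\<^sub>R q 3"
    by (simp add: curved_acceleration_def UNIV_4_diff F_def m c31 c32 c34 vv)
  \<comment> \<open>The rotation turns \<open>q 1\<close> into \<open>q 3\<close> and
    \<open>q 2\<close> into \<open>q 4\<close>, so the \<open>F 1 2\<close> terms, the velocity
    terms and all multiples of \<open>q 3\<close> coming from the constraint cancel.\<close>
  have "F 1 3 *\<^sub>R (hyp_rotation \<phi> (q 3) - q 1) + F 1 4 *\<^sub>R (hyp_rotation \<phi> (q 4) - q 2) = 0"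
    using acc unfolding a1 a3
    by (simp add: R.add R.scaleR R1 R2 algebra_simps)
  \<comment> \<open>In the \<open>y\<close> coordinate both differences equal the same number, so
    the coefficients add up. Unlike \<open>z\<close>, it involves the injective function
    \<open>sinh\<close>.\<close>
  from arg_cong[OF this, of "\<lambda>a. a $ 3"]
  have "F 1 3 * (hyp_rotation \<phi> (q 3) $ 3 - q 1 $ 3)
      + F 1 4 * (hyp_rotation \<phi> (q 4) $ 3 - q 2 $ 3) = 0"
    by (simp del: hyp_rotation_nth)
  moreover have "hyp_rotation \<phi> (q 3) $ 3 = \<eta> * sinh (\<beta> + \<phi> + \<phi>)"
    and "hyp_rotation \<phi> (q 4) $ 3 = \<eta> * sinh (\<beta> + \<phi> + \<phi>)"
    by (simp_all only: hyp_rotation_nth q3 q4 vector_4_nth sinh_add[of "\<beta> + \<phi>" \<phi>]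
        distrib_left mult.assoc)
  ultimately have "(F 1 3 + F 1 4) * (\<eta> * (sinh (\<beta> + \<phi> + \<phi>) - sinh \<beta>)) = 0"
    by (simp add: q1 q2 distrib_right right_diff_distrib)
  moreover have "sinh (\<beta> + \<phi> + \<phi>) \<noteq> sinh \<beta>"
    using \<phi> by simp
  \<comment> \<open>Strict positivity needs a nonzero denominator, as division by zero yields 0. By
    \<open>h\<close> the product \<open>q 1 \<odot> q 3\<close> lies strictly below -1.\<close>
  moreover have "F 1 3 > 0"
  proof -
    have "cosh \<phi> > 1"
      using \<phi> cosh_real_ge_1[of \<phi>] cosh_real_one_iff[of \<phi>] by linarith
    then have "\<eta>\<^sup>2 * (cosh \<phi> - 1) > 0"
      using \<eta> by simp
    moreover have cosh_\<phi>: "cosh \<phi> = cosh \<beta> * cosh (\<beta> + \<phi>) - sinh \<beta> * sinh (\<beta> + \<phi>)"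
      using cosh_diff[of "\<beta> + \<phi>" \<beta>] by (simp add: mult.commute)
    have "q 1 \<odot> q 3 = w\<^sup>2 + x\<^sup>2 - \<eta>\<^sup>2 * cosh \<phi>"
      unfolding lorentz_def q1 q3 vector_4_nth cosh_\<phi>
      by (simp add: power2_eq_square algebra_simps)
    then have "q 1 \<odot> q 3 = - 1 - \<eta>\<^sup>2 * (cosh \<phi> - 1)"
      using h by (simp add: algebra_simps)
    ultimately have "\<bar>q 1 \<odot> q 3\<bar> > 1"
      by linarith
    then have "(q 1 \<odot> q 3)\<^sup>2 > 1"
      using one_less_power[of "\<bar>q 1 \<odot> q 3\<bar>" 2] by simp
    then show ?thesis
      using \<mu> by (simp add: F_def)
  qed
  \<comment> \<open>Since \<open>powr\<close> is never negative, this holds whatever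
    \<open>q 1 \<odot> q 4\<close> is, and it suffices for a positive sum.\<close>
  moreover have "F 1 4 \<ge> 0"
    using \<mu> by (simp add: F_def)
  ultimately show False
    using \<eta> by auto
qed

theorem theorem6:
  fixes m :: "4 \<Rightarrow> real" and \<mu> :: real
  assumes "\<mu> > 0" and "m 1 = \<mu>" and "m 2 = \<mu>" and "m 3 = \<mu>" and "m 4 = \<mu>"
  shows "\<not> (\<exists>I q. negative_hyperbolic_rectangular_rotopulsator m I q)"
proof
  assume "\<exists>I q. negative_hyperbolic_rectangular_rotopulsator m I q"
  then obtain I q where rot: "negative_hyperbolic_rectangular_rotopulsator m I q"
    by blast
  then obtain w x \<eta> \<beta> \<phi> where h: "\<forall>t\<in>I. (w t)\<^sup>2 + (x t)\<^sup>2 - (\<eta> t)\<^sup>2 = -1" and \<phi>: "\<phi> \<noteq> 0"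
    and shape: "\<forall>t\<in>I.
      q 1 t = vector [w t, x t, \<eta> t * sinh (\<beta> t), \<eta> t * cosh (\<beta> t)] \<and>
      q 2 t = vector [- w t, - x t, \<eta> t * sinh (\<beta> t), \<eta> t * cosh (\<beta> t)] \<and>
      q 3 t = vector [w t, x t, \<eta> t * sinh (\<beta> t + \<phi>), \<eta> t * cosh (\<beta> t + \<phi>)] \<and>
      q 4 t = vector [- w t, - x t, \<eta> t * sinh (\<beta> t + \<phi>), \<eta> t * cosh (\<beta> t + \<phi>)]"
    unfolding negative_hyperbolic_rectangular_rotopulsator_def
    by (elim exE conjE) (rule that)
  have sol: "curved_nbody_solution m I q"
    using rot unfolding negative_hyperbolic_rectangular_rotopulsator_def by (rule conjunct1)
  then have I: "is_interval I" "interior I \<noteq> {}" "0 \<in> I"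
    and H: "\<forall>t\<in>I. \<forall>i. q i t \<in> hyperbolic_space"
    unfolding curved_nbody_solution_def by simp_all
  from sol obtain v where v: "\<forall>t\<in>I. \<forall>i. (q i has_vector_derivative v i t) (at t within I) \<and>
      (v i has_vector_derivative curved_acceleration m (\<lambda>j. q j t) (\<lambda>j. v j t) i) (at t within I)"
    unfolding curved_nbody_solution_def by (elim exE conjE) (rule that)
  have dq: "(q i has_vector_derivative v i t) (at t within I)"
    and dv: "(v i has_vector_derivative curved_acceleration m (\<lambda>j. q j t) (\<lambda>j. v j t) i)
      (at t within I)" if "t \<in> I" for i t
    using v that by simp_all
  note q0 = bspec[OF shape I(3)]
  have q13: "q 3 t = hyp_rotation \<phi> (q 1 t)" if "t \<in> I" for t
    by (simp add: vec_eq_iff forall_4 shape that sinh_add cosh_add algebra_simps)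
  \<comment> \<open>Established on all of \<open>I\<close>, because this relation is differentiated
    once more to relate the accelerations.\<close>
  have v13: "v 3 t = hyp_rotation \<phi> (v 1 t)" if "t \<in> I" for t
    by (rule has_vector_derivative_linear_image_unique[OF
          bounded_linear_hyp_rotation I(1,2) that q13 dq[OF that] dq[OF that]])
  have acc: "curved_acceleration m (\<lambda>j. q j 0) (\<lambda>j. v j 0) 3
      = hyp_rotation \<phi> (curved_acceleration m (\<lambda>j. q j 0) (\<lambda>j. v j 0) 1)"
    by (rule has_vector_derivative_linear_image_unique[OF
          bounded_linear_hyp_rotation I v13 dv[OF I(3)] dv[OF I(3)]])
  \<comment> \<open>On the upper sheet \<open>z > 0\<close>, and for body 1 this coordinate is
    \<open>\<eta> 0 * cosh (\<beta> 0)\<close>.\<close>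
  have "\<eta> 0 > 0"
    using bspec[OF H I(3), THEN spec, of 1] q0 cosh_real_pos[of "\<beta> 0"]
    by (auto simp: hyperbolic_space_def zero_less_mult_iff)
  then have "\<phi> = 0"
    using rectangle_rotation_angle_zero[where q = "\<lambda>j. q j 0" and v = "\<lambda>j. v j 0"]
      assms bspec[OF h I(3)] q0 v13[OF I(3)] acc by blast
  with \<phi> show False
    by contradiction
qed

end
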